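(* For all integers $m,n,m',n'\ge 0$ and every $(z,w)\in\mathbb{C}^2$, $$H_{m,n,m',n'}(z,w)=e^{-(A_{\xi}A_{\overline{\xi}}+A_{\xi^*}A_{\widetilde{\xi}})}\left(\xi^{m}\,\overline{\xi}^{\,n}\,(\xi^* )^{m'}\,\widetilde{\xi}^{\,n'}\right).$$
   Context: For integers $m,n\ge 0$ and $\zeta\in\mathbb{C}$, $H_{m,n}(\zeta,\overline{\zeta})=(-1)^{m+n}e^{|\zeta|^2}\frac{\partial^{m+n}}{\partial\overline{\zeta}^{m}\partial\zeta^{n}}\left(e^{-|\zeta|^2}\right)$ (Wirtinger derivatives). For $(z,w)\in\mathbb{C}^2$ set $\xi=z+iw$, $\overline{\xi}=\overline{z}-i\overline{w}$, $\xi^*=\overline{z}+i\overline{w}$, $\widetilde{\xi}=z-iw$, and define $H_{m,n,m',n'}(z,w)=H_{m,n}(\xi,\overline{\xi})\,H_{m',n'}(\xi^*,\widetilde{\xi})$. The first order differential operators are $A_{\xi}=\frac12\left(\frac{\partial}{\partial z}-i\frac{\partial}{\partial w}\right)$, $A_{\xi^*}=\frac12\left(\frac{\partial}{\partial\overline{z}}-i\frac{\partial}{\partial\overline{w}}\right)$, $A_{\overline{\xi}}=\frac12\left(\frac{\partial}{\partial\overline{z}}+i\frac{\partial}{\partial\overline{w}}\right)$, $A_{\widetilde{\xi}}=\frac12\left(\frac{\partial}{\partial z}+i\frac{\partial}{\partial w}\right)$. For a differential operator $T$ that is locally nilpotent on polynomials, $e^{-T}P=\sum_{k\ge 0}\frac{(-1)^k}{k!}T^kP$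 (a finite sum for each polynomial $P$ in $z,\overline{z},w,\overline{w}$). *)

theory Defs
  imports "HOL-Analysis.Analysis"
begin

text \<open>
  Wirtinger derivatives of a (real-differentiable) function on the complex plane, with
  \<open>\<zeta> = x + \<i> y\<close>: \<open>\<partial>/\<partial>\<zeta> = (\<partial>/\<partial>x - \<i> \<partial>/\<partial>y) / 2\<close> and \<open>\<partial>/\<partial>cnj \<zeta> = (\<partial>/\<partial>x + \<i> \<partial>/\<partial>y) / 2\<close>.
\<close>

definition deriv_x :: "(complex \<Rightarrow> complex) \<Rightarrow> complex \<Rightarrow> complex" where
  "deriv_x f \<zeta> = vector_derivative (\<lambda>t::real. f (\<zeta> + of_real t)) (at 0)"

definition deriv_y :: "(complex \<Rightarrow> complex) \<Rightarrow> complex \<Rightarrow> complex" where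
  "deriv_y f \<zeta> = vector_derivative (\<lambda>t::real. f (\<zeta> + \<i> * of_real t)) (at 0)"

definition wirtinger :: "(complex \<Rightarrow> complex) \<Rightarrow> complex \<Rightarrow> complex" where
  "wirtinger f \<zeta> = (deriv_x f \<zeta> - \<i> * deriv_y f \<zeta>) / 2"

definition wirtinger_bar :: "(complex \<Rightarrow> complex) \<Rightarrow> complex \<Rightarrow> complex" where
  "wirtinger_bar f \<zeta> = (deriv_x f \<zeta> + \<i> * deriv_y f \<zeta>) / 2"

text \<open>
  The complex Hermite polynomial \<open>H\<^sub>m\<^sub>,\<^sub>n(\<zeta>, cnj \<zeta>)\<close>. Its second argument is always the conjugate of
  the first one and is therefore not passed separately.
\<close>

definition hermite2 :: "nat \<Rightarrow> nat \<Rightarrow> complex \<Rightarrow> complex" where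
  "hermite2 m n \<zeta> =
     (-1) ^ (m + n) * exp (of_real ((cmod \<zeta>)\<^sup>2)) *
     (wirtinger_bar ^^ m) ((wirtinger ^^ n) (\<lambda>\<eta>. exp (- of_real ((cmod \<eta>)\<^sup>2)))) \<zeta>"

definition xi :: "complex \<times> complex \<Rightarrow> complex" where
  "xi = (\<lambda>(z, w). z + \<i> * w)"

definition xi_bar :: "complex \<times> complex \<Rightarrow> complex" where
  "xi_bar = (\<lambda>(z, w). cnj z - \<i> * cnj w)"

definition xi_star :: "complex \<times> complex \<Rightarrow> complex" where
  "xi_star = (\<lambda>(z, w). cnj z + \<i> * cnj w)"

definition xi_tilde :: "complex \<times> complex \<Rightarrow> complex" where
  "xi_tilde = (\<lambda>(z, w). z - \<i> * w)"

lemma cnj_xi: "cnj (xi p) = xi_bar p"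
  by (cases p) (simp add: xi_def xi_bar_def)

lemma cnj_xi_star: "cnj (xi_star p) = xi_tilde p"
  by (cases p) (simp add: xi_star_def xi_tilde_def)

text \<open>
  By the two preceding lemmas, the second arguments of the two factors
  \<open>H\<^sub>m\<^sub>,\<^sub>n(\<xi>, xi_bar)\<close> and \<open>H\<^sub>m\<^sub>'\<^sub>,\<^sub>n\<^sub>'(xi_star, xi_tilde)\<close> are the conjugates of the first.
\<close>

definition hermite4 :: "nat \<Rightarrow> nat \<Rightarrow> nat \<Rightarrow> nat \<Rightarrow> complex \<times> complex \<Rightarrow> complex" where
  "hermite4 m n m' n' p = hermite2 m n (xi p) * hermite2 m' n' (xi_star p)"

type_synonym operator = "(complex \<times> complex \<Rightarrow> complex) \<Rightarrow> complex \<times> complex \<Rightarrow> complex"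

definition d_z :: operator where
  "d_z F = (\<lambda>(z, w). wirtinger (\<lambda>\<zeta>. F (\<zeta>, w)) z)"

definition d_zbar :: operator where
  "d_zbar F = (\<lambda>(z, w). wirtinger_bar (\<lambda>\<zeta>. F (\<zeta>, w)) z)"

definition d_w :: operator where
  "d_w F = (\<lambda>(z, w). wirtinger (\<lambda>\<zeta>. F (z, \<zeta>)) w)"

definition d_wbar :: operator where
  "d_wbar F = (\<lambda>(z, w). wirtinger_bar (\<lambda>\<zeta>. F (z, \<zeta>)) w)"

definition A_xi :: operator where
  "A_xi F = (\<lambda>p. (d_z F p - \<i> * d_w F p) / 2)"

definition A_xi_star :: operator where
  "A_xi_star F = (\<lambda>p. (d_zbar F p - \<i> * d_wbar F p) / 2)"

definition A_xi_bar :: operator where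
  "A_xi_bar F = (\<lambda>p. (d_zbar F p + \<i> * d_wbar F p) / 2)"

definition A_xi_tilde :: operator where
  "A_xi_tilde F = (\<lambda>p. (d_z F p + \<i> * d_w F p) / 2)"

text \<open>
  The operator \<open>e\<^sup>-\<^sup>T\<close>. It is meant for \<open>T\<close> and \<open>P\<close> such that \<open>(T ^^ k) P\<close> vanishes for all large \<open>k\<close>,
  and then the series is a finite sum.
\<close>

definition exp_neg :: "operator \<Rightarrow> operator" where
  "exp_neg T P = (\<lambda>p. \<Sum>k. (-1) ^ k / fact k * (T ^^ k) P p)"

end

theory Submission
  imports Defs
begin

text \<open>
  The forms \<open>\<xi>, xi_bar, xi_star, xi_tilde\<close> are real-linear coordinates on \<open>\<complex>\<^sup>2\<close> whose dual partial
  derivatives are exactly the four operators \<open>A\<close>. Hence the operator in the exponent is a sum of two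
  commuting Laplacians \<open>D\<^sub>1 + D\<^sub>2\<close> acting on separate pairs of variables, and the exponential of the
  sum is the Cauchy product of the two exponentials. Each of these equals a complex Hermite
  polynomial, because both sides are
  \<open>\<Sum>k. (-1)\<^sup>k k! (m choose k) (n choose k) \<zeta>\<^sup>m\<^sup>-\<^sup>k (cnj \<zeta>)\<^sup>n\<^sup>-\<^sup>k\<close>.
\<close>

section \<open>Wirtinger derivatives from the total derivative\<close>

text \<open>Lets derivative calculus replace the directional derivatives of the definitions: along 1
  and \<open>\<i>\<close> the given map takes the values a + b and \<open>\<i>\<close> * (a - b),
  and the Wirtinger combinations solve this system for a and b.\<close>

lemma
  assumes "(f has_derivative (\<lambda>h. a * h + b * cnj h)) (at \<zeta>)"
  shows wirtinger_eqI: "wirtinger f \<zeta> = a"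
    and wirtinger_bar_eqI: "wirtinger_bar f \<zeta> = b"
proof -
  have line: "((\<lambda>t::real. f (\<zeta> + v * of_real t)) has_vector_derivative a * v + b * cnj v) (at 0)"
    for v
  proof -
    have "((\<lambda>t::real. \<zeta> + v * of_real t) has_derivative (\<lambda>t. v * of_real t)) (at 0)"
      by (auto intro!: derivative_eq_intros)
    then have "((\<lambda>t::real. f (\<zeta> + v * of_real t)) has_derivative
        (\<lambda>t. a * (v * of_real t) + b * cnj (v * of_real t))) (at 0)"
      by (rule has_derivative_compose[where g = f]) (use assms in simp)
    then show ?thesis
      by (simp add: has_vector_derivative_def scaleR_conv_of_real algebra_simps)
  qed
  have x: "deriv_x f \<zeta> = a + b"
    using vector_derivative_at[OF line[of 1]] by (simp add: deriv_x_def)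
  have y: "deriv_y f \<zeta> = a * \<i> - b * \<i>"
    using vector_derivative_at[OF line[of \<i>]] by (simp add: deriv_y_def)
  show "wirtinger f \<zeta> = a" "wirtinger_bar f \<zeta> = b"
    by (simp_all add: wirtinger_def wirtinger_bar_def x y algebra_simps)
qed

text \<open>Duality of the operators and the linear forms. Restricting the derivative to each slot
  gives Wirtinger derivatives a + d and b + c in z, \<open>\<i>\<close> * (a - d) and
  \<open>\<i>\<close> * (c - b) in w; each operator isolates one coefficient.\<close>

lemma
  assumes "(F has_derivative
    (\<lambda>h. a * xi h + b * xi_bar h + c * xi_star h + d * xi_tilde h)) (at p)"
  shows A_xi_eqI: "A_xi F p = a"
    and A_xi_bar_eqI: "A_xi_bar F p = b"
    and A_xi_star_eqI: "A_xi_star F p = c"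
    and A_xi_tilde_eqI: "A_xi_tilde F p = d"
proof -
  obtain z w where p: "p = (z, w)" by (cases p)
  have "((\<lambda>\<zeta>. (\<zeta>, w)) has_derivative (\<lambda>h. (h, 0))) (at z)"
    by (auto intro!: derivative_eq_intros)
  from has_derivative_compose[OF this, of F, OF assms[unfolded p]]
  have z: "((\<lambda>\<zeta>. F (\<zeta>, w)) has_derivative (\<lambda>h. (a + d) * h + (b + c) * cnj h)) (at z)"
    by (simp add: xi_def xi_bar_def xi_star_def xi_tilde_def algebra_simps)
  have "((\<lambda>\<zeta>. (z, \<zeta>)) has_derivative (\<lambda>h. (0, h))) (at w)"
    by (auto intro!: derivative_eq_intros)
  from has_derivative_compose[OF this, of F, OF assms[unfolded p]]
  have w: "((\<lambda>\<zeta>. F (z, \<zeta>)) has_derivative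
      (\<lambda>h. (\<i> * (a - d)) * h + (\<i> * (c - b)) * cnj h)) (at w)"
    by (simp add: xi_def xi_bar_def xi_star_def xi_tilde_def algebra_simps)
  note d = wirtinger_eqI[OF z] wirtinger_bar_eqI[OF z] wirtinger_eqI[OF w] wirtinger_bar_eqI[OF w]
  show "A_xi F p = a" "A_xi_bar F p = b" "A_xi_star F p = c" "A_xi_tilde F p = d"
    by (simp_all add: p d A_xi_def A_xi_bar_def A_xi_star_def A_xi_tilde_def
        d_z_def d_zbar_def d_w_def d_wbar_def algebra_simps)
qed

section \<open>The operators on polynomials in the linear forms\<close>

lemma
  shows has_derivative_xi: "(xi has_derivative xi) F"
    and has_derivative_xi_bar: "(xi_bar has_derivative xi_bar) F"
    and has_derivative_xi_star: "(xi_star has_derivative xi_star) F"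
    and has_derivative_xi_tilde: "(xi_tilde has_derivative xi_tilde) F"
  unfolding xi_def xi_bar_def xi_star_def xi_tilde_def case_prod_beta
  by (auto intro!: derivative_eq_intros)

definition xi_monom :: "nat \<Rightarrow> nat \<Rightarrow> nat \<Rightarrow> nat \<Rightarrow> complex \<times> complex \<Rightarrow> complex" where
  "xi_monom m n m' n' p = xi p ^ m * xi_bar p ^ n * xi_star p ^ m' * xi_tilde p ^ n'"

text \<open>Truncated subtraction is harmless here: whenever an exponent is 0, so is the factor in
  front.\<close>

lemma has_derivative_xi_monom:
  "(xi_monom m n m' n' has_derivative
     (\<lambda>h. of_nat m * xi_monom (m - 1) n m' n' p * xi h
        + of_nat n * xi_monom m (n - 1) m' n' p * xi_bar h
        + of_nat m' * xi_monom m n (m' - 1) n' p * xi_star h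
        + of_nat n' * xi_monom m n m' (n' - 1) p * xi_tilde h)) (at p)"
  unfolding xi_monom_def
  by (rule derivative_eq_intros has_derivative_xi has_derivative_xi_bar
      has_derivative_xi_star has_derivative_xi_tilde refl)+
    (simp add: algebra_simps)

text \<open>Coefficients and exponents are arbitrary families, so each derivative is again a sum of
  this shape and the rules below can be iterated for second-order operators.\<close>

lemma has_derivative_sum_xi_monom:
  "((\<lambda>p. \<Sum>i\<in>I. c i * xi_monom (m i) (n i) (m' i) (n' i) p) has_derivative
     (\<lambda>h. (\<Sum>i\<in>I. c i * of_nat (m i) * xi_monom (m i - 1) (n i) (m' i) (n' i) p) * xi h
        + (\<Sum>i\<in>I. c i * of_nat (n i) * xi_monom (m i) (n i - 1) (m' i) (n' i) p) * xi_bar h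
        + (\<Sum>i\<in>I. c i * of_nat (m' i) * xi_monom (m i) (n i) (m' i - 1) (n' i) p) * xi_star h
        + (\<Sum>i\<in>I. c i * of_nat (n' i) * xi_monom (m i) (n i) (m' i) (n' i - 1) p) * xi_tilde h))
   (at p)"
  by (rule has_derivative_eq_rhs,
      rule has_derivative_sum,
      rule has_derivative_mult_right,
      rule has_derivative_xi_monom)
    (simp add: sum_distrib_left sum.distrib algebra_simps)

lemmas A_sum_xi_monom =
  A_xi_eqI[OF has_derivative_sum_xi_monom] A_xi_bar_eqI[OF has_derivative_sum_xi_monom]
  A_xi_star_eqI[OF has_derivative_sum_xi_monom] A_xi_tilde_eqI[OF has_derivative_sum_xi_monom]

section \<open>Powers of the Laplacian on a monomial\<close>

definition laplace_coeff :: "nat \<Rightarrow> nat \<Rightarrow> nat \<Rightarrow> nat" where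
  "laplace_coeff m n k = fact k * (m choose k) * (n choose k)"

lemma diff_times_binomial: "(n - k) * (n choose k) = Suc k * (n choose Suc k)"
  by (metis binomial_absorb_comp binomial_absorption mult.commute diff_Suc_1)

text \<open>\<open>laplace_coeff m n k\<close> is the coefficient produced by the k-th power of a
  mixed second derivative, divided by k!. One more differentiation contributes (m - k) * (n - k),
  and passing from k! to (k + 1)! leaves the factor \<open>Suc k\<close>.\<close>

lemma laplace_coeff_Suc:
  "laplace_coeff m n k * ((m - k) * (n - k)) = Suc k * laplace_coeff m n (Suc k)"
  using diff_times_binomial[of m k] diff_times_binomial[of n k]
  by (simp add: laplace_coeff_def) algebra

definition laplace :: operator where
  "laplace F = (\<lambda>p. A_xi (A_xi_bar F) p + A_xi_star (A_xi_tilde F) p)"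

text \<open>The monomial after the divided powers D1^i / i! and D2^j / j! of the two commuting
  summands of \<open>laplace\<close>.\<close>

definition laplace_term where
  "laplace_term m n m' n' i j =
     (\<lambda>p. of_nat (laplace_coeff m n i * laplace_coeff m' n' j)
        * xi_monom (m - i) (n - i) (m' - j) (n' - j) p)"

lemma laplace_sum_term:
  "laplace (\<lambda>p. \<Sum>i\<in>I. c i * laplace_term m n m' n' (f i) (g i) p) =
   (\<lambda>p. \<Sum>i\<in>I. c i * (of_nat (Suc (f i)) * laplace_term m n m' n' (Suc (f i)) (g i) p
                      + of_nat (Suc (g i)) * laplace_term m n m' n' (f i) (Suc (g i)) p))"
proof
  fix p
  have coeff: "of_nat (laplace_coeff m n k) * (of_nat (n - k) * of_nat (m - k)) =
      (of_nat (Suc k) * of_nat (laplace_coeff m n (Suc k)) :: complex)" for m n k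
    by (simp only: flip: of_nat_mult laplace_coeff_Suc) (simp add: mult.commute)
  have eq: "(\<lambda>p. \<Sum>i\<in>I. c i * laplace_term m n m' n' (f i) (g i) p) =
    (\<lambda>p. \<Sum>i\<in>I. (c i * of_nat (laplace_coeff m n (f i) * laplace_coeff m' n' (g i)))
      * xi_monom (m - f i) (n - f i) (m' - g i) (n' - g i) p)"
    by (simp add: laplace_term_def mult.assoc)
  have 1: "of_nat (laplace_coeff m n i * laplace_coeff m' n' j) * of_nat (n - i) * of_nat (m - i)
      * xi_monom (m - i - 1) (n - i - 1) (m' - j) (n' - j) p
    = of_nat (Suc i) * laplace_term m n m' n' (Suc i) j p" for i j
    using coeff[of m n i] by (simp add: laplace_term_def del: of_nat_Suc)
  have 2: "of_nat (laplace_coeff m n i * laplace_coeff m' n' j) * of_nat (n' - j) * of_nat (m' - j)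
      * xi_monom (m - i) (n - i) (m' - j - 1) (n' - j - 1) p
    = of_nat (Suc j) * laplace_term m n m' n' i (Suc j) p" for i j
    using coeff[of m' n' j] by (simp add: laplace_term_def del: of_nat_Suc)
  show "laplace (\<lambda>p. \<Sum>i\<in>I. c i * laplace_term m n m' n' (f i) (g i) p) p =
    (\<Sum>i\<in>I. c i * (of_nat (Suc (f i)) * laplace_term m n m' n' (Suc (f i)) (g i) p
                      + of_nat (Suc (g i)) * laplace_term m n m' n' (f i) (Suc (g i)) p))"
    unfolding laplace_def eq A_sum_xi_monom sum.distrib[symmetric]
    by (intro sum.cong refl) (simp only: 1[symmetric] 2[symmetric] mult.assoc distrib_left)
qed

text \<open>The binomial theorem for two commuting operators; with divided powers the binomial
  coefficients disappear.\<close>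

lemma laplace_funpow:
  "(laplace ^^ k) (xi_monom m n m' n') =
     (\<lambda>p. \<Sum>i\<le>k. fact k * laplace_term m n m' n' i (k - i) p)"
proof (induction k)
  case 0
  show ?case by (simp add: laplace_term_def laplace_coeff_def)
next
  case (Suc k)
  let ?t = "laplace_term m n m' n'"
  have "(\<Sum>i\<le>k. fact k * (of_nat (Suc i) * ?t (Suc i) (k - i) p
          + of_nat (Suc (k - i)) * ?t i (Suc (k - i)) p))
      = (\<Sum>i\<le>Suc k. fact (Suc k) * ?t i (Suc k - i) p)" for p
  proof -
    \<comment> \<open>Both sums are extended to the antidiagonal of \<open>Suc k\<close>. The added
      end term, i = 0 here and i = \<open>Suc k\<close> in the next sum, has weight 0.\<close>
    have "(\<Sum>i\<le>k. of_nat (Suc i) * ?t (Suc i) (k - i) p)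
        = (\<Sum>i\<le>Suc k. of_nat i * ?t i (Suc k - i) p)"
      by (subst sum.atMost_Suc_shift) simp
    moreover have "(\<Sum>i\<le>k. of_nat (Suc (k - i)) * ?t i (Suc (k - i)) p)
        = (\<Sum>i\<le>Suc k. of_nat (Suc k - i) * ?t i (Suc k - i) p)"
      by (simp add: Suc_diff_le del: of_nat_Suc of_nat_diff)
    \<comment> \<open>The weights i and \<open>Suc k - i\<close> add up to \<open>Suc k\<close>,
      which turns \<open>fact k\<close> into \<open>fact (Suc k)\<close>.\<close>
    moreover have "(\<Sum>i\<le>Suc k. of_nat i * ?t i (Suc k - i) p)
        + (\<Sum>i\<le>Suc k. of_nat (Suc k - i) * ?t i (Suc k - i) p)
        = of_nat (Suc k) * (\<Sum>i\<le>Suc k. ?t i (Suc k - i) p)"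
      unfolding sum.distrib[symmetric] sum_distrib_left
      by (intro sum.cong refl) (simp only: distrib_right[symmetric] of_nat_add[symmetric], simp)
    ultimately show ?thesis
      unfolding sum_distrib_left[symmetric] sum.distrib by (simp only: fact_Suc) (simp add: mult_ac)
  qed
  then show ?case
    by (simp only: funpow.simps o_apply Suc.IH laplace_sum_term)
qed

section \<open>Complex Hermite polynomials\<close>

definition gauss :: "complex \<Rightarrow> complex" where
  "gauss \<eta> = exp (- of_real ((cmod \<eta>)\<^sup>2))"

lemma has_derivative_gauss:
  "(gauss has_derivative (\<lambda>h. - cnj \<zeta> * gauss \<zeta> * h + - \<zeta> * gauss \<zeta> * cnj h)) (at \<zeta>)"
proof -
  have gauss: "gauss = (\<lambda>\<eta>. exp (- (\<eta> * cnj \<eta>)))"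
    by (simp add: gauss_def fun_eq_iff complex_norm_square del: of_real_power)
  have "((\<lambda>\<eta>. - (\<eta> * cnj \<eta>)) has_derivative (\<lambda>h. - (\<zeta> * cnj h + h * cnj \<zeta>))) (at \<zeta>)"
    by (auto intro!: derivative_eq_intros)
  from has_derivative_compose[OF this DERIV_exp[unfolded has_field_derivative_def]] show ?thesis
    unfolding gauss by (simp add: algebra_simps)
qed

lemma wirtinger_funpow_gauss: "(wirtinger ^^ n) gauss = (\<lambda>\<eta>. (- 1) ^ n * cnj \<eta> ^ n * gauss \<eta>)"
proof (induction n)
  case (Suc n)
  have "wirtinger (\<lambda>\<eta>. (- 1) ^ n * cnj \<eta> ^ n * gauss \<eta>) \<zeta> =
      (- 1) ^ Suc n * cnj \<zeta> ^ Suc n * gauss \<zeta>" for \<zeta>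
    \<comment> \<open>The witness is the coefficient of \<open>cnj h\<close> in the total
      derivative; the conclusion does not determine it.\<close>
    by (rule wirtinger_eqI[where b = "(- 1) ^ n *
          (of_nat n * cnj \<zeta> ^ (n - 1) - \<zeta> * cnj \<zeta> ^ n) * gauss \<zeta>"])
      (auto intro!: derivative_eq_intros has_derivative_gauss simp: algebra_simps)
  then show ?case by (simp only: funpow.simps o_apply Suc.IH)
qed simp

definition hermite_term :: "nat \<Rightarrow> nat \<Rightarrow> complex \<Rightarrow> nat \<Rightarrow> complex" where
  "hermite_term m n \<zeta> k = (- 1) ^ k * of_nat (laplace_coeff m n k) * \<zeta> ^ (m - k) * cnj \<zeta> ^ (n - k)"

lemma hermite_term_eq_0: "m < k \<Longrightarrow> hermite_term m n \<zeta> k = 0"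
  by (simp add: hermite_term_def laplace_coeff_def)

text \<open>The derivative of \<open>hermite_term\<close> with respect to
  \<open>cnj \<zeta>\<close>.\<close>

definition hermite_term_dbar :: "nat \<Rightarrow> nat \<Rightarrow> complex \<Rightarrow> nat \<Rightarrow> complex" where
  "hermite_term_dbar m n \<zeta> k =
     (- 1) ^ k * of_nat (laplace_coeff m n k) * \<zeta> ^ (m - k) * (of_nat (n - k) * cnj \<zeta> ^ (n - k - 1))"

text \<open>The raising recurrence in m, matching the product rule for the conjugate derivative of a
  polynomial times the Gaussian. It holds term by term by Pascal's rule for
  \<open>Suc m choose Suc k\<close>.\<close>

lemma sum_hermite_term_Suc:
  "(\<Sum>k\<le>Suc m. hermite_term (Suc m) n \<zeta> k) =
     \<zeta> * (\<Sum>k\<le>m. hermite_term m n \<zeta> k) - (\<Sum>k\<le>m. hermite_term_dbar m n \<zeta> k)"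
proof -
  have step: "hermite_term (Suc m) n \<zeta> (Suc k) =
      \<zeta> * hermite_term m n \<zeta> (Suc k) - hermite_term_dbar m n \<zeta> k" if "k \<le> m" for k
  proof -
    have "laplace_coeff (Suc m) n (Suc k) = laplace_coeff m n (Suc k)
        + fact k * (m choose k) * (Suc k * (n choose Suc k))"
      by (simp add: laplace_coeff_def algebra_simps)
    then have "laplace_coeff (Suc m) n (Suc k)
        = laplace_coeff m n (Suc k) + laplace_coeff m n k * (n - k)"
      unfolding diff_times_binomial[symmetric] by (simp add: laplace_coeff_def mult_ac)
    then have coeff: "(of_nat (laplace_coeff (Suc m) n (Suc k)) :: complex)
        = of_nat (laplace_coeff m n (Suc k)) + of_nat (laplace_coeff m n k) * of_nat (n - k)"
      by (simp only: of_nat_add of_nat_mult)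
    \<comment> \<open>For k = m the truncated exponent makes the powers differ, but then the
      coefficient contains \<open>m choose Suc m\<close> = 0.\<close>
    have pow: "of_nat (laplace_coeff m n (Suc k)) * \<zeta> ^ (m - k)
        = of_nat (laplace_coeff m n (Suc k)) * (\<zeta> * \<zeta> ^ (m - Suc k))"
    proof (cases "k = m")
      case True
      then show ?thesis by (simp add: laplace_coeff_def)
    next
      case False
      with that have "m - k = Suc (m - Suc k)" by simp
      then show ?thesis by simp
    qed
    have "hermite_term (Suc m) n \<zeta> (Suc k)
      = - ((- 1) ^ k * (of_nat (laplace_coeff m n (Suc k)) * \<zeta> ^ (m - k)) * cnj \<zeta> ^ (n - Suc k))
        - hermite_term_dbar m n \<zeta> k"
      unfolding hermite_term_def hermite_term_dbar_def coeff by (simp add: algebra_simps)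
    then show ?thesis
      unfolding pow by (simp add: hermite_term_def algebra_simps)
  qed
  have 0: "hermite_term (Suc m) n \<zeta> 0 = \<zeta> * hermite_term m n \<zeta> 0"
    by (simp add: hermite_term_def laplace_coeff_def)
  have "(\<Sum>k\<le>Suc m. hermite_term (Suc m) n \<zeta> k) =
      \<zeta> * (\<Sum>k\<le>Suc m. hermite_term m n \<zeta> k) - (\<Sum>k\<le>m. hermite_term_dbar m n \<zeta> k)"
    unfolding sum.atMost_Suc_shift[of _ m]
    by (simp add: 0 step sum_subtractf sum_distrib_left distrib_left)
  then show ?thesis by (simp add: hermite_term_eq_0)
qed

lemma has_derivative_hermite_term:
  "((\<lambda>\<eta>. hermite_term m n \<eta> k) has_derivative
     (\<lambda>h. (- 1) ^ k * of_nat (laplace_coeff m n k) * of_nat (m - k) * \<zeta> ^ (m - k - 1)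
            * cnj \<zeta> ^ (n - k) * h + hermite_term_dbar m n \<zeta> k * cnj h)) (at \<zeta>)"
  unfolding hermite_term_def hermite_term_dbar_def
  by (auto intro!: derivative_eq_intros simp: algebra_simps)

lemma wirtinger_bar_hermite_gauss:
  "wirtinger_bar (\<lambda>\<eta>. c * (\<Sum>k\<le>m. hermite_term m n \<eta> k) * gauss \<eta>) \<zeta>
   = - c * (\<Sum>k\<le>Suc m. hermite_term (Suc m) n \<zeta> k) * gauss \<zeta>"
proof -
  \<comment> \<open>The \<zeta>-derivative of the sum, which completes the total derivative demanded
    by \<open>wirtinger_bar_eqI\<close>.\<close>
  define D where "D = (\<Sum>k\<le>m. (- 1) ^ k * of_nat (laplace_coeff m n k) * of_nat (m - k)
    * \<zeta> ^ (m - k - 1) * cnj \<zeta> ^ (n - k))"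
  have "((\<lambda>\<eta>. \<Sum>k\<le>m. hermite_term m n \<eta> k) has_derivative
      (\<lambda>h. D * h + (\<Sum>k\<le>m. hermite_term_dbar m n \<zeta> k) * cnj h)) (at \<zeta>)"
    by (rule has_derivative_eq_rhs, rule has_derivative_sum, rule has_derivative_hermite_term)
      (simp add: D_def sum.distrib sum_distrib_right)
  note this[derivative_intros]
  show ?thesis
    unfolding sum_hermite_term_Suc
    by (rule wirtinger_bar_eqI[where a = "c * (D - cnj \<zeta> * (\<Sum>k\<le>m. hermite_term m n \<zeta> k)) * gauss \<zeta>"])
      (auto intro!: derivative_eq_intros has_derivative_gauss simp: algebra_simps)
qed

text \<open>The constant c makes room for the sign (-1)^n left by the n derivatives in
  \<zeta>.\<close>

lemma wirtinger_bar_funpow_gauss: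
  "(wirtinger_bar ^^ m) (\<lambda>\<eta>. c * cnj \<eta> ^ n * gauss \<eta>) =
     (\<lambda>\<eta>. (- 1) ^ m * c * (\<Sum>k\<le>m. hermite_term m n \<eta> k) * gauss \<eta>)"
proof (induction m)
  case 0
  show ?case by (simp add: hermite_term_def laplace_coeff_def)
next
  case (Suc m)
  show ?case
    by (simp only: funpow.simps o_apply Suc.IH wirtinger_bar_hermite_gauss power_Suc) simp
qed

text \<open>The two Gaussian factors cancel and the signs square to 1. The finite sum is stated as a
  series to fit the Cauchy product.\<close>

lemma hermite2_sums: "hermite_term m n \<zeta> sums hermite2 m n \<zeta>"
proof -
  have "gauss = (\<lambda>\<eta>. exp (- of_real ((cmod \<eta>)\<^sup>2)))"
    by (simp add: gauss_def fun_eq_iff)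
  note gauss = this[symmetric]
  have "hermite2 m n \<zeta> = (- 1) ^ (m + n) * exp (of_real ((cmod \<zeta>)\<^sup>2)) *
      ((- 1) ^ m * (- 1) ^ n * (\<Sum>k\<le>m. hermite_term m n \<zeta> k) * gauss \<zeta>)"
    unfolding hermite2_def
    by (simp only: wirtinger_bar_funpow_gauss wirtinger_funpow_gauss gauss)
  also have "\<dots> = ((- 1) ^ (m + n) * (- 1) ^ (m + n)) * (exp (of_real ((cmod \<zeta>)\<^sup>2)) * gauss \<zeta>)
      * (\<Sum>k\<le>m. hermite_term m n \<zeta> k)"
    by (simp add: power_add mult_ac)
  also have "\<dots> = (\<Sum>k\<le>m. hermite_term m n \<zeta> k)"
    by (simp add: gauss_def flip: exp_add power_mult_distrib)
  finally show ?thesis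
    using sums_finite[of "{..m}" "hermite_term m n \<zeta>"] by (simp add: hermite_term_eq_0)
qed

lemma summable_norm_hermite_term: "summable (\<lambda>k. norm (hermite_term m n \<zeta> k))"
  by (rule summable_finite[of "{..m}"]) (auto simp: hermite_term_eq_0)

section \<open>The exponential of the sum as a Cauchy product\<close>

theorem theorem3p9:
  fixes m n m' n' :: nat and z w :: complex
  shows "hermite4 m n m' n' (z, w) =
    exp_neg (\<lambda>F p. A_xi (A_xi_bar F) p + A_xi_star (A_xi_tilde F) p)
      (\<lambda>p. xi p ^ m * xi_bar p ^ n * xi_star p ^ m' * xi_tilde p ^ n') (z, w)"
proof -
  let ?u = "hermite_term m n (xi (z, w))" and ?v = "hermite_term m' n' (xi_star (z, w))"
  have eq: "(\<lambda>F p. A_xi (A_xi_bar F) p + A_xi_star (A_xi_tilde F) p) = laplace"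
    "(\<lambda>p. xi p ^ m * xi_bar p ^ n * xi_star p ^ m' * xi_tilde p ^ n') = xi_monom m n m' n'"
    by (simp_all add: fun_eq_iff laplace_def xi_monom_def)
  have summand: "(- 1) ^ k * laplace_term m n m' n' i (k - i) (z, w) = ?u i * ?v (k - i)"
    if "i \<le> k" for i k
  proof -
    have "(- 1) ^ k = (- 1) ^ i * ((- 1) ^ (k - i) :: complex)"
      using that by (simp flip: power_add)
    then show ?thesis
      by (simp add: laplace_term_def hermite_term_def xi_monom_def cnj_xi cnj_xi_star mult_ac)
  qed
  \<comment> \<open>The \<open>fact k\<close> from \<open>laplace_funpow\<close> cancels the
    denominator of the exponential series, so the k-th term is the sum over the antidiagonal i + j =
    k.\<close>
  have "exp_neg laplace (xi_monom m n m' n') (z, w) = (\<Sum>k. \<Sum>i\<le>k. ?u i * ?v (k - i))"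
    by (simp add: exp_neg_def laplace_funpow summand sum_distrib_left[symmetric])
      (simp add: sum_distrib_left summand)
  also have "\<dots> = suminf ?u * suminf ?v"
    by (intro Cauchy_product[symmetric] summable_norm_hermite_term)
  also have "\<dots> = hermite4 m n m' n' (z, w)"
    by (simp add: hermite4_def sums_unique[OF hermite2_sums])
  finally show ?thesis by (simp only: eq)
qed

end
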